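(* Let $(M,\mu,S)$ be a Weyl triple (with $M$ connected). Then the associated three-point kernel $K=e^{iS}$ is geometrically associative.
   Context: A Weyl triple is a triple $(M,\mu,S)$ where $M$ is an oriented manifold endowed with a volume form $\mu$ and $S:M\times M\times M\to\mathbb R$ is a smooth function such that: (i) $S(x,y,z)=S(z,x,y)=-S(y,x,z)$ for all $x,y,z\in M$; (ii) for all $m\in M$, $S(x,y,z)=S(x,y,m)+S(y,z,m)+S(z,x,m)$ for all $x,y,z\in M$; (iii) for all $x\in M$ there exists a $\mu$-preserving diffeomorphism $s_x:M\to M$ such that $S(x,y,z)=-S(x,s_x(y),z)$ for all $y,z\in M$. A (complex valued) three-point kernel $K\in C^\infty(M\times M\times M)$ on an orientable manifold $M$ with volume form $\mu$ is called geometrically associative if for every quadruple of points $a,b,c,d$ in $M$ there exists a volume preserving diffeomorphism $\varphi:(M,\mu)\to(M,\mu)$ such that for all $t\in M$: $K(a,b,t)K(t,c,d)=K(a,\varphi(t),d)K(\varphi(t),b,c)$. *)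

theory Defs
  imports "HOL-Analysis.Analysis"
begin

section \<open>Smooth maps between open subsets of normed spaces\<close>

text \<open>On open subsets of finite-dimensional spaces this is the usual \<open>C\<^sup>k\<close>: all
  iterated directional derivatives of order at most \<open>k\<close> exist and are continuous.\<close>

primrec higher_differentiable_on ::
    "'a::real_normed_vector set \<Rightarrow> ('a \<Rightarrow> 'b::real_normed_vector) \<Rightarrow> nat \<Rightarrow> bool" where
  "higher_differentiable_on S f 0 \<longleftrightarrow> continuous_on S f"
| "higher_differentiable_on S f (Suc k) \<longleftrightarrow>
     (\<forall>x\<in>S. f differentiable (at x)) \<and>
     (\<forall>v. higher_differentiable_on S (\<lambda>x. frechet_derivative f (at x) v) k)"

definition smooth_on ::
    "'a::real_normed_vector set \<Rightarrow> ('a \<Rightarrow> 'b::real_normed_vector) \<Rightarrow> bool" where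
  "smooth_on S f \<longleftrightarrow> (\<forall>k. higher_differentiable_on S f k)"


section \<open>Alternating forms on a finite-dimensional vector space\<close>

text \<open>A \<open>k\<close>-tuple of vectors is a function \<open>v :: nat \<Rightarrow> 'e\<close> of which only the entries
  \<open>v 0, \<dots>, v (k - 1)\<close> matter.\<close>

definition alternating_form :: "nat \<Rightarrow> ((nat \<Rightarrow> 'e::real_vector) \<Rightarrow> real) \<Rightarrow> bool" where
  "alternating_form k \<omega> \<longleftrightarrow>
     (\<forall>v w. (\<forall>i<k. v i = w i) \<longrightarrow> \<omega> v = \<omega> w) \<and>
     (\<forall>v. \<forall>i<k. linear (\<lambda>u. \<omega> (v(i := u)))) \<and>
     (\<forall>v. \<forall>i<k. \<forall>j<k. i \<noteq> j \<and> v i = v j \<longrightarrow> \<omega> v = 0)"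

abbreviation top_form :: "((nat \<Rightarrow> 'e::real_vector) \<Rightarrow> real) \<Rightarrow> bool" where
  "top_form \<equiv> alternating_form (dim (UNIV :: 'e set))"

text \<open>The determinant of an endomorphism of a finite-dimensional space is the scalar by which
  it acts on the one-dimensional space of top-degree alternating forms.\<close>

definition linear_det :: "('e::real_vector \<Rightarrow> 'e) \<Rightarrow> real" where
  "linear_det L = (THE c. \<forall>\<omega>. top_form \<omega> \<longrightarrow> (\<forall>v. \<omega> (\<lambda>i. L (v i)) = c * \<omega> v))"


section \<open>Manifolds\<close>

text \<open>A chart is a pair of a domain in \<open>M\<close> and a coordinate map; the values of the coordinate
  map outside the domain are irrelevant. An atlas need not be maximal.\<close>

type_synonym ('a, 'e) chart = "'a set \<times> ('a \<Rightarrow> 'e)"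

record ('a, 'e) manifold =
  points :: "'a topology"
  atlas :: "('a, 'e) chart set"

definition chart_image :: "('a, 'e) chart \<Rightarrow> 'e set" where
  "chart_image c = snd c ` fst c"

definition chart_inv :: "('a, 'e) chart \<Rightarrow> 'e \<Rightarrow> 'a" where
  "chart_inv c = inv_into (fst c) (snd c)"

definition is_chart :: "'a topology \<Rightarrow> ('a, 'e::real_normed_vector) chart \<Rightarrow> bool" where
  "is_chart X c \<longleftrightarrow> openin X (fst c) \<and> open (chart_image c) \<and>
     homeomorphic_map (subtopology X (fst c)) (top_of_set (chart_image c)) (snd c)"

text \<open>The expression of a map \<open>f\<close> in the charts \<open>c\<close> (source) and \<open>c'\<close> (target), and its domain.
  For \<open>f = id\<close> these are the transition maps.\<close>

definition local_expr ::
    "('a, 'e) chart \<Rightarrow> ('b, 'f) chart \<Rightarrow> ('a \<Rightarrow> 'b) \<Rightarrow> 'e \<Rightarrow> 'f" where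
  "local_expr c c' f = snd c' \<circ> f \<circ> chart_inv c"

definition local_dom ::
    "('a, 'e) chart \<Rightarrow> ('b, 'f) chart \<Rightarrow> ('a \<Rightarrow> 'b) \<Rightarrow> 'e set" where
  "local_dom c c' f = snd c ` (fst c \<inter> f -` fst c')"

text \<open>Any finite-dimensional normed space is allowed as model space, so that
  \<open>0\<close>-dimensional manifolds are covered too.\<close>

definition smooth_manifold :: "('a, 'e::real_normed_vector) manifold \<Rightarrow> bool" where
  "smooth_manifold M \<longleftrightarrow>
     (\<exists>B :: 'e set. finite B \<and> span B = UNIV) \<and>
     Hausdorff_space (points M) \<and> second_countable (points M) \<and>
     (\<forall>c\<in>atlas M. is_chart (points M) c) \<and>
     (\<Union>c\<in>atlas M. fst c) = topspace (points M) \<and>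
     (\<forall>c\<in>atlas M. \<forall>c'\<in>atlas M. smooth_on (local_dom c c' id) (local_expr c c' id))"

text \<open>The orientation is given by the atlas itself, which is required to be an oriented one.\<close>

definition oriented_manifold :: "('a, 'e::real_normed_vector) manifold \<Rightarrow> bool" where
  "oriented_manifold M \<longleftrightarrow> smooth_manifold M \<and>
     (\<forall>c\<in>atlas M. \<forall>c'\<in>atlas M. \<forall>x\<in>local_dom c c' id.
        linear_det (frechet_derivative (local_expr c c' id) (at x)) > 0)"

definition prod_manifold ::
    "('a, 'e) manifold \<Rightarrow> ('b, 'f) manifold \<Rightarrow> ('a \<times> 'b, 'e \<times> 'f) manifold" where
  "prod_manifold M N =
     \<lparr>points = prod_topology (points M) (points N),
      atlas = {(fst c \<times> fst d, map_prod (snd c) (snd d)) | c d. c \<in> atlas M \<and> d \<in> atlas N}\<rparr>"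

definition smooth_function ::
    "('a, 'e::real_normed_vector) manifold \<Rightarrow> ('a \<Rightarrow> 'b::real_normed_vector) \<Rightarrow> bool" where
  "smooth_function M f \<longleftrightarrow> (\<forall>c\<in>atlas M. smooth_on (chart_image c) (f \<circ> chart_inv c))"

definition smooth_kernel ::
    "('a, 'e::real_normed_vector) manifold \<Rightarrow>
      ('a \<Rightarrow> 'a \<Rightarrow> 'a \<Rightarrow> 'b::real_normed_vector) \<Rightarrow> bool" where
  "smooth_kernel M K \<longleftrightarrow>
     smooth_function (prod_manifold M (prod_manifold M M)) (\<lambda>(x, y, z). K x y z)"

definition smooth_map ::
    "('a, 'e::real_normed_vector) manifold \<Rightarrow> ('b, 'f::real_normed_vector) manifold \<Rightarrow>
      ('a \<Rightarrow> 'b) \<Rightarrow> bool" where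
  "smooth_map M N f \<longleftrightarrow> continuous_map (points M) (points N) f \<and>
     (\<forall>c\<in>atlas M. \<forall>d\<in>atlas N. smooth_on (local_dom c d f) (local_expr c d f))"

definition diffeomorphism ::
    "('a, 'e::real_normed_vector) manifold \<Rightarrow> ('b, 'f::real_normed_vector) manifold \<Rightarrow>
      ('a \<Rightarrow> 'b) \<Rightarrow> bool" where
  "diffeomorphism M N f \<longleftrightarrow> bij_betw f (topspace (points M)) (topspace (points N)) \<and>
     smooth_map M N f \<and> smooth_map N M (inv_into (topspace (points M)) f)"


section \<open>Volume forms\<close>

text \<open>A top-degree form on \<open>M\<close> is represented by its coordinate expressions: \<open>\<mu> c x\<close> is the
  alternating form at the coordinate point \<open>x\<close> of the chart \<open>c\<close>.\<close>

type_synonym ('a, 'e) diff_form = "('a, 'e) chart \<Rightarrow> 'e \<Rightarrow> (nat \<Rightarrow> 'e) \<Rightarrow> real"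

text \<open>The expression in the chart \<open>c\<close> of the pullback of \<open>\<mu>\<close> under \<open>f\<close>, computed by means of the
  chart \<open>c'\<close> in the target:\<close>

definition pullback_expr ::
    "('a, 'e::real_normed_vector) diff_form \<Rightarrow> ('a, 'e) chart \<Rightarrow> ('a, 'e) chart \<Rightarrow>
      ('a \<Rightarrow> 'a) \<Rightarrow> 'e \<Rightarrow> (nat \<Rightarrow> 'e) \<Rightarrow> real" where
  "pullback_expr \<mu> c c' f x v =
     \<mu> c' (local_expr c c' f x) (\<lambda>i. frechet_derivative (local_expr c c' f) (at x) (v i))"

definition preserves_form ::
    "('a, 'e::real_normed_vector) manifold \<Rightarrow> ('a, 'e) diff_form \<Rightarrow> ('a \<Rightarrow> 'a) \<Rightarrow> bool" where
  "preserves_form M \<mu> f \<longleftrightarrow>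
     (\<forall>c\<in>atlas M. \<forall>c'\<in>atlas M. \<forall>x\<in>local_dom c c' f. pullback_expr \<mu> c c' f x = \<mu> c x)"

text \<open>The last conjunct is the compatibility of the coordinate expressions under
  transition maps.\<close>

definition volume_form ::
    "('a, 'e::real_normed_vector) manifold \<Rightarrow> ('a, 'e) diff_form \<Rightarrow> bool" where
  "volume_form M \<mu> \<longleftrightarrow>
     (\<forall>c\<in>atlas M.
        (\<forall>x\<in>chart_image c. top_form (\<mu> c x) \<and> (\<exists>v. \<mu> c x v \<noteq> 0)) \<and>
        (\<forall>v. smooth_on (chart_image c) (\<lambda>x. \<mu> c x v))) \<and>
     preserves_form M \<mu> id"

definition volume_preserving_diffeo ::
    "('a, 'e::real_normed_vector) manifold \<Rightarrow> ('a, 'e) diff_form \<Rightarrow> ('a \<Rightarrow> 'a) \<Rightarrow> bool" where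
  "volume_preserving_diffeo M \<mu> f \<longleftrightarrow> diffeomorphism M M f \<and> preserves_form M \<mu> f"


section \<open>Weyl triples and geometric associativity\<close>

definition weyl_triple ::
    "('a, 'e::real_normed_vector) manifold \<Rightarrow> ('a, 'e) diff_form \<Rightarrow>
      ('a \<Rightarrow> 'a \<Rightarrow> 'a \<Rightarrow> real) \<Rightarrow> bool" where
  "weyl_triple M \<mu> S \<longleftrightarrow>
     oriented_manifold M \<and> volume_form M \<mu> \<and> smooth_kernel M S \<and>
     (let P = topspace (points M) in
       (\<forall>x\<in>P. \<forall>y\<in>P. \<forall>z\<in>P. S x y z = S z x y \<and> S z x y = - S y x z) \<and>
       (\<forall>m\<in>P. \<forall>x\<in>P. \<forall>y\<in>P. \<forall>z\<in>P. S x y z = S x y m + S y z m + S z x m) \<and>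
       (\<forall>x\<in>P. \<exists>s. volume_preserving_diffeo M \<mu> s \<and>
          (\<forall>y\<in>P. \<forall>z\<in>P. S x y z = - S x (s y) z)))"

definition geometrically_associative ::
    "('a, 'e::real_normed_vector) manifold \<Rightarrow> ('a, 'e) diff_form \<Rightarrow>
      ('a \<Rightarrow> 'a \<Rightarrow> 'a \<Rightarrow> complex) \<Rightarrow> bool" where
  "geometrically_associative M \<mu> K \<longleftrightarrow>
     smooth_kernel M K \<and>
     (let P = topspace (points M) in
       \<forall>a\<in>P. \<forall>b\<in>P. \<forall>c\<in>P. \<forall>d\<in>P. \<exists>\<phi>. volume_preserving_diffeo M \<mu> \<phi> \<and>
         (\<forall>t\<in>P. K a b t * K t c d = K a (\<phi> t) d * K (\<phi> t) b c))"

end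

theory Submission
  imports Defs
begin

text \<open>Put \<open>H x = S a b x + S c d x - S d a x - S b c x\<close>. Splitting all triangles at \<open>x\<close>, the
  symmetry \<open>s\<close> at \<open>x\<close> satisfies
  \<open>S a b t + S t c d = S a (s t) d + S (s t) b c + H x\<close>,
  so \<open>s\<close> serves as \<open>\<phi>\<close> as soon as \<open>H x = 0\<close>. Since \<open>H a = - H c\<close>, such an \<open>x\<close> exists by
  connectedness.\<close>

section \<open>Smooth maps\<close>

text \<open>Since \<open>S\<close> is open, agreement on \<open>S\<close> is agreement near each of
  its points, so the Frechet derivatives at points of \<open>S\<close> coincide and the induction
  passes to them.\<close>

lemma higher_differentiable_on_cong:
  assumes "open S" "\<And>x. x \<in> S \<Longrightarrow> f x = g x" "higher_differentiable_on S f k"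
  shows "higher_differentiable_on S g k"
  using assms(2,3)
proof (induction k arbitrary: f g)
  case 0
  then show ?case using continuous_on_eq by force
next
  case (Suc k)
  have der: "(g has_derivative frechet_derivative f (at x)) (at x)" if "x \<in> S" for x
    using has_derivative_transform_within_open[OF _ assms(1) that, of f _ UNIV g] Suc.prems that
    by (simp add: frechet_derivative_works)
  have eq: "frechet_derivative f (at x) = frechet_derivative g (at x)" if "x \<in> S" for x
    using frechet_derivative_at[OF der[OF that]] .
  show ?case
    unfolding higher_differentiable_on.simps
  proof (intro conjI allI ballI)
    show "g differentiable at x" if "x \<in> S" for x
      using der[OF that] differentiable_def by blast
    show "higher_differentiable_on S (\<lambda>x. frechet_derivative g (at x) v) k" for v
      by (rule Suc.IH[of "\<lambda>x. frechet_derivative f (at x) v"]) (use Suc.prems eq in auto)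
  qed
qed

text \<open>By uniqueness of the derivative, any explicit formula \<open>f'\<close> may stand for
  \<open>frechet_derivative\<close>, which is only defined by choice. The closure proofs below feed
  it the usual differentiation rules.\<close>

lemma higher_differentiable_on_SucI:
  assumes "open S"
    and "\<And>x. x \<in> S \<Longrightarrow> (f has_derivative f' x) (at x)"
    and "\<And>v. higher_differentiable_on S (\<lambda>x. f' x v) k"
  shows "higher_differentiable_on S f (Suc k)"
  unfolding higher_differentiable_on.simps
proof (intro conjI allI ballI)
  show "f differentiable at x" if "x \<in> S" for x
    using assms(2)[OF that] differentiable_def by blast
  show "higher_differentiable_on S (\<lambda>x. frechet_derivative f (at x) v) k" for v
    by (rule higher_differentiable_on_cong[OF assms(1) _ assms(3)[of v]])
       (simp add: frechet_derivative_at[OF assms(2), symmetric])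
qed

lemma higher_differentiable_on_Suc_has_derivative:
  assumes "higher_differentiable_on S f (Suc k)" "x \<in> S"
  shows "(f has_derivative frechet_derivative f (at x)) (at x)"
  using assms by (simp add: frechet_derivative_works)

lemma higher_differentiable_on_SucD:
  assumes "higher_differentiable_on S f (Suc k)"
  shows "higher_differentiable_on S f k"
  using assms
proof (induction k arbitrary: f)
  case 0
  then show ?case
    by (auto intro: continuous_at_imp_continuous_on differentiable_imp_continuous_within)
next
  case (Suc k)
  then show ?case by (metis higher_differentiable_on.simps(2))
qed

section \<open>Closure of k times differentiable maps under sums, products, linear maps and
  exponentials\<close>

lemma higher_differentiable_on_add:
  assumes "open S" "higher_differentiable_on S f k" "higher_differentiable_on S g k"
  shows "higher_differentiable_on S (\<lambda>x. f x + g x) k"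
  using assms(2,3)
proof (induction k arbitrary: f g)
  case 0
  then show ?case by (simp add: continuous_on_add)
next
  case (Suc k)
  note der = Suc.prems[THEN higher_differentiable_on_Suc_has_derivative]
  show ?case
    by (rule higher_differentiable_on_SucI[OF assms(1) has_derivative_add[OF der]])
       (use Suc in auto)
qed

lemma higher_differentiable_on_mult:
  fixes f g :: "'a::real_normed_vector \<Rightarrow> 'b::real_normed_algebra"
  assumes "open S" "higher_differentiable_on S f k" "higher_differentiable_on S g k"
  shows "higher_differentiable_on S (\<lambda>x. f x * g x) k"
  using assms(2,3)
proof (induction k arbitrary: f g)
  case 0
  then show ?case by (simp add: continuous_on_mult)
next
  case (Suc k)
  note der = Suc.prems[THEN higher_differentiable_on_Suc_has_derivative]
  \<comment> \<open>The product rule leaves one factor of each summand undifferentiated; its order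
    must drop to \<open>k\<close> before the induction hypothesis applies.\<close>
  note low = Suc.prems[THEN higher_differentiable_on_SucD]
  show ?case
    by (rule higher_differentiable_on_SucI[OF assms(1) has_derivative_mult[OF der]])
       (use Suc low in \<open>auto intro!: higher_differentiable_on_add assms(1)\<close>)
qed

lemma higher_differentiable_on_bounded_linear:
  assumes "open S" "bounded_linear L" "higher_differentiable_on S f k"
  shows "higher_differentiable_on S (\<lambda>x. L (f x)) k"
  using assms(3)
proof (induction k arbitrary: f)
  case 0
  then show ?case by (simp add: bounded_linear.continuous_on[OF assms(2)])
next
  case (Suc k)
  note der = Suc.prems[THEN higher_differentiable_on_Suc_has_derivative]
  show ?case
    by (rule higher_differentiable_on_SucI
          [OF assms(1) bounded_linear.has_derivative[OF assms(2) der]])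
       (use Suc in auto)
qed

text \<open>The derivative \<open>exp (f x) * frechet_derivative f (at x) v\<close> contains
  \<open>exp (f x)\<close> again, but only at order \<open>k\<close>, where the induction hypothesis
  covers it; the product lemma does the rest.\<close>

lemma higher_differentiable_on_exp:
  fixes f :: "'a::real_normed_vector \<Rightarrow> 'b::{real_normed_field,banach}"
  assumes "open S" "higher_differentiable_on S f k"
  shows "higher_differentiable_on S (\<lambda>x. exp (f x)) k"
  using assms(2)
proof (induction k arbitrary: f)
  case 0
  then show ?case by (simp add: continuous_on_exp)
next
  case (Suc k)
  have der: "((\<lambda>x. exp (f x)) has_derivative (\<lambda>v. exp (f x) * frechet_derivative f (at x) v)) (at x)"
    if "x \<in> S" for x
    using has_derivative_compose[OF higher_differentiable_on_Suc_has_derivative[OF Suc.prems that]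
        has_field_derivative_imp_has_derivative[OF DERIV_exp]] .
  show ?case
    by (rule higher_differentiable_on_SucI[OF assms(1) der])
       (use Suc higher_differentiable_on_SucD[OF Suc.prems] in
         \<open>auto intro!: higher_differentiable_on_mult assms(1)\<close>)
qed

lemma smooth_on_exp_i:
  assumes "open S" "smooth_on S f"
  shows "smooth_on S (\<lambda>x. exp (\<i> * complex_of_real (f x)))"
proof -
  \<comment> \<open>Viewing multiplication by \<open>\<i>\<close> as a real-linear map from the
    reals to the complex numbers reduces the phase to a linear map followed by
    \<open>exp\<close>.\<close>
  have L: "bounded_linear (\<lambda>r. \<i> * complex_of_real r)"
    by (intro bounded_linear_const_mult bounded_linear_of_real)
  have "higher_differentiable_on S f k" for k
    using assms(2) by (simp add: smooth_on_def)
  from higher_differentiable_on_exp[OF assms(1)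
      higher_differentiable_on_bounded_linear[OF assms(1) L this]]
  show ?thesis
    by (simp add: smooth_on_def)
qed

section \<open>Smooth functions on manifolds\<close>

text \<open>Isolates the conditions on charts that pass easily to products, so that the lemmas on
  functions apply to the triple product on which a kernel lives.\<close>

definition topological_atlas :: "('a, 'e::real_normed_vector) manifold \<Rightarrow> bool" where
  "topological_atlas M \<longleftrightarrow>
     (\<forall>c\<in>atlas M. is_chart (points M) c) \<and> (\<Union>c\<in>atlas M. fst c) = topspace (points M)"

section \<open>Products of charts and of manifolds\<close>

lemma is_chart_prod:
  assumes "is_chart X c" "is_chart Y d"
  shows "is_chart (prod_topology X Y) (fst c \<times> fst d, map_prod (snd c) (snd d))"
proof -
  have img: "map_prod (snd c) (snd d) ` (fst c \<times> fst d) = snd c ` fst c \<times> snd d ` fst d"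
    by (rule map_prod_image)
  obtain f' g' where
    "homeomorphic_maps (subtopology X (fst c)) (top_of_set (snd c ` fst c)) (snd c) f'"
    "homeomorphic_maps (subtopology Y (fst d)) (top_of_set (snd d ` fst d)) (snd d) g'"
    using assms unfolding is_chart_def chart_image_def homeomorphic_map_maps by blast
  then have "homeomorphic_maps
      (prod_topology (subtopology X (fst c)) (subtopology Y (fst d)))
      (prod_topology (top_of_set (snd c ` fst c)) (top_of_set (snd d ` fst d)))
      (\<lambda>(x, y). (snd c x, snd d y)) (\<lambda>(x, y). (f' x, g' y))"
    unfolding homeomorphic_maps_prod by blast
  \<comment> \<open>By \<open>subtopology_Times\<close>, the product of the subspace topologies is
    the subspace topology of the product of the domains.\<close>
  then have "homeomorphic_map (subtopology (prod_topology X Y) (fst c \<times> fst d))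
      (top_of_set (snd c ` fst c \<times> snd d ` fst d)) (map_prod (snd c) (snd d))"
    unfolding homeomorphic_map_maps map_prod_def by (auto simp: subtopology_Times)
  then show ?thesis
    using assms unfolding is_chart_def chart_image_def
    by (auto simp: img openin_prod_Times_iff open_Times)
qed

lemma points_prod_manifold:
  "points (prod_manifold M N) = prod_topology (points M) (points N)"
  by (simp add: prod_manifold_def)

text \<open>The image form lets unions over the product atlas be computed by
  \<open>image_image\<close> and \<open>UN_Times_distrib\<close>.\<close>

lemma atlas_prod_manifold:
  "atlas (prod_manifold M N)
    = (\<lambda>(c, d). (fst c \<times> fst d, map_prod (snd c) (snd d))) ` (atlas M \<times> atlas N)"
proof -
  have *: "{g c d |c d. c \<in> A \<and> d \<in> B} = (\<lambda>(c, d). g c d) ` (A \<times> B)"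
    for g :: "'p \<Rightarrow> 'q \<Rightarrow> 'r" and A B
    by auto
  show ?thesis
    unfolding prod_manifold_def manifold.simps by (rule *)
qed

lemma topological_atlas_prod:
  assumes "topological_atlas M" "topological_atlas N"
  shows "topological_atlas (prod_manifold M N)"
  unfolding topological_atlas_def
proof (intro conjI ballI)
  show "is_chart (points (prod_manifold M N)) e" if e: "e \<in> atlas (prod_manifold M N)" for e
  proof -
    obtain c d where "c \<in> atlas M" "d \<in> atlas N"
      and e: "e = (fst c \<times> fst d, map_prod (snd c) (snd d))"
      using e unfolding atlas_prod_manifold by (elim imageE SigmaE) simp
    then show ?thesis
      unfolding e points_prod_manifold using assms
      by (intro is_chart_prod) (simp_all add: topological_atlas_def)
  qed
  have "(\<Union>e\<in>atlas (prod_manifold M N). fst e)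
      = (\<Union>(c, d)\<in>atlas M \<times> atlas N. fst c \<times> fst d)"
    unfolding atlas_prod_manifold image_image case_prod_unfold fst_conv ..
  also have "\<dots> = (\<Union>c\<in>atlas M. fst c) \<times> (\<Union>d\<in>atlas N. fst d)"
    by (rule UN_Times_distrib)
  finally show "(\<Union>e\<in>atlas (prod_manifold M N). fst e) = topspace (points (prod_manifold M N))"
    using assms unfolding topological_atlas_def points_prod_manifold by simp
qed

lemma smooth_manifold_topological_atlas:
  "smooth_manifold M \<Longrightarrow> topological_atlas M"
  by (simp add: smooth_manifold_def topological_atlas_def)

text \<open>On a chart domain \<open>f\<close> is its continuous coordinate expression composed with
  the coordinate map. The open chart domains cover the space, so these restrictions paste
  together.\<close>

lemma smooth_function_continuous_map:
  assumes M: "topological_atlas M" and f: "smooth_function M f"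
  shows "continuous_map (points M) euclidean f"
proof (rule pasting_lemma[where I = "atlas M" and T = fst and f = "\<lambda>_. f"])
  fix c assume c: "c \<in> atlas M"
  then have hom: "homeomorphic_map (subtopology (points M) (fst c)) (top_of_set (chart_image c)) (snd c)"
    and op: "openin (points M) (fst c)"
    using M by (auto simp: topological_atlas_def is_chart_def)
  show "openin (points M) (fst c)" by (rule op)
  have top: "topspace (subtopology (points M) (fst c)) = fst c"
    using openin_subset[OF op] by (simp add: Int_absorb1)
  have inj: "inj_on (snd c) (fst c)"
    using homeomorphic_imp_injective_map[OF hom] by (simp only: top)
  \<comment> \<open>Smoothness at order 0 is continuity.\<close>
  have "higher_differentiable_on (chart_image c) (f \<circ> chart_inv c) 0"
    using f c unfolding smooth_function_def smooth_on_def by blast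
  then have "continuous_map (top_of_set (chart_image c)) euclidean (f \<circ> chart_inv c)"
    by simp
  from continuous_map_compose[OF homeomorphic_imp_continuous_map[OF hom] this]
  show "continuous_map (subtopology (points M) (fst c)) euclidean f"
    by (rule continuous_map_eq) (use inj in \<open>simp add: top chart_inv_def\<close>)
next
  show "\<exists>c. c \<in> atlas M \<and> x \<in> fst c \<and> f x = f x" if "x \<in> topspace (points M)" for x
    using M that unfolding topological_atlas_def by blast
qed simp

lemma smooth_function_exp_i:
  assumes M: "topological_atlas M" and f: "smooth_function M f"
  shows "smooth_function M (\<lambda>x. exp (\<i> * complex_of_real (f x)))"
  unfolding smooth_function_def
proof
  fix c assume c: "c \<in> atlas M"
  then have "open (chart_image c)" using M by (simp add: topological_atlas_def is_chart_def)
  moreover have "smooth_on (chart_image c) (f \<circ> chart_inv c)"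
    using f c by (simp add: smooth_function_def)
  ultimately show "smooth_on (chart_image c) ((\<lambda>x. exp (\<i> * complex_of_real (f x))) \<circ> chart_inv c)"
    unfolding o_def by (rule smooth_on_exp_i)
qed

text \<open>Joint continuity on the triple product is restricted along the slice
  \<open>x \<mapsto> (a, b, x)\<close>. This is the form in which \<open>S\<close> occurs in the
  function \<open>H\<close> of the main proof.\<close>

lemma smooth_kernel_continuous_map:
  assumes "topological_atlas M" "smooth_kernel M S" "a \<in> topspace (points M)" "b \<in> topspace (points M)"
  shows "continuous_map (points M) euclidean (S a b)"
proof -
  have "continuous_map (prod_topology (points M) (prod_topology (points M) (points M))) euclidean
      (\<lambda>(x, y, z). S x y z)"
    using smooth_function_continuous_map[of "prod_manifold M (prod_manifold M M)"] assms
    by (simp add: topological_atlas_prod smooth_kernel_def points_prod_manifold)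
  moreover have "continuous_map (points M)
      (prod_topology (points M) (prod_topology (points M) (points M))) (\<lambda>x. (a, b, x))"
    using assms by (intro continuous_map_pairedI) auto
  ultimately show ?thesis
    using continuous_map_compose[of "points M" _ "\<lambda>x. (a, b, x)" euclidean "\<lambda>(x, y, z). S x y z"]
    by (simp add: o_def)
qed

lemma smooth_kernel_exp_i:
  assumes "topological_atlas M" "smooth_kernel M S"
  shows "smooth_kernel M (\<lambda>x y z. exp (\<i> * complex_of_real (S x y z)))"
  using smooth_function_exp_i[of "prod_manifold M (prod_manifold M M)" "\<lambda>(x, y, z). S x y z"] assms
  by (simp add: topological_atlas_prod smooth_kernel_def case_prod_unfold)

section \<open>Weyl triples\<close>

text \<open>The image of \<open>h\<close> is connected, hence an interval, and 0 lies between the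
  opposite values \<open>h p\<close> and \<open>h q\<close>.\<close>

lemma connected_space_zero:
  fixes h :: "'a \<Rightarrow> real"
  assumes "connected_space X" "continuous_map X euclidean h"
    and "p \<in> topspace X" "q \<in> topspace X" "h p = - h q"
  obtains x where "x \<in> topspace X" "h x = 0"
proof -
  have "connected (h ` topspace X)"
    using connectedin_continuous_map_image[OF assms(2), of "topspace X"] assms(1)
    by (simp add: connectedin_topspace)
  moreover have "h p \<in> h ` topspace X" "h q \<in> h ` topspace X"
    by (rule imageI, rule assms)+
  moreover have "h p \<le> 0 \<and> 0 \<le> h q \<or> h q \<le> 0 \<and> 0 \<le> h p" using assms(5) by linarith
  ultimately have "0 \<in> h ` topspace X"
    unfolding connected_iff_interval by blast
  then show thesis using that by (metis imageE)
qed

theorem proposition1p3: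
  fixes M :: "('a, 'e::real_normed_vector) manifold"
    and \<mu> :: "('a, 'e) diff_form"
    and S :: "'a \<Rightarrow> 'a \<Rightarrow> 'a \<Rightarrow> real"
  assumes "weyl_triple M \<mu> S"
    and "connected_space (points M)"
  shows "geometrically_associative M \<mu> (\<lambda>x y z. exp (\<i> * complex_of_real (S x y z)))"
proof -
  define P where "P = topspace (points M)"
  have atl: "topological_atlas M"
    using assms(1) by (simp add: weyl_triple_def oriented_manifold_def smooth_manifold_topological_atlas)
  have smooth: "smooth_kernel M S"
    using assms(1) by (simp add: weyl_triple_def)
  have cyc: "S x y z = S z x y" and alt: "S z x y = - S y x z"
    if "x \<in> P" "y \<in> P" "z \<in> P" for x y z
    using assms(1) that unfolding weyl_triple_def Let_def P_def by blast+
  have cocycle: "S x y z = S x y m + S y z m + S z x m"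
    if "m \<in> P" "x \<in> P" "y \<in> P" "z \<in> P" for m x y z
    using assms(1) that unfolding weyl_triple_def Let_def P_def by blast
  \<comment> \<open>Antisymmetry with a repeated point makes \<open>S x y x\<close> its own
    negative; a cyclic shift gives the other case.\<close>
  have degenerate: "S x y x = 0" "S y x x = 0" if "x \<in> P" "y \<in> P" for x y
    using alt[OF that(2,1,1)] cyc[OF that(2,1,1)] by linarith+
  have symmetry: "\<exists>s. volume_preserving_diffeo M \<mu> s \<and> (\<forall>y\<in>P. \<forall>z\<in>P. S x y z = - S x (s y) z)"
    if "x \<in> P" for x
    using assms(1) that unfolding weyl_triple_def Let_def P_def by blast
  have "\<exists>\<phi>. volume_preserving_diffeo M \<mu> \<phi> \<and>
      (\<forall>t\<in>P. S a b t + S t c d = S a (\<phi> t) d + S (\<phi> t) b c)"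
    if abcd: "a \<in> P" "b \<in> P" "c \<in> P" "d \<in> P" for a b c d
  proof -
    define H where "H x = S a b x + S c d x - S d a x - S b c x" for x
    have "continuous_map (points M) euclidean H"
      unfolding H_def
      by (intro continuous_map_add continuous_map_diff smooth_kernel_continuous_map[OF atl smooth]
          abcd[unfolded P_def])
    \<comment> \<open>The degenerate triangles drop out, leaving
      \<open>H a = S c d a - S b c a\<close> and \<open>H c = S a b c - S d a c\<close>; cyclic
      shifts match the terms.\<close>
    moreover have "H a = - H c"
      using cyc[OF abcd(1-3)] cyc[OF abcd(4,1,3)] degenerate[OF abcd(1,2)] degenerate[OF abcd(1,4)]
        degenerate[OF abcd(3,2)] degenerate[OF abcd(3,4)] cyc[OF abcd(2,3,1)]
      unfolding H_def by linarith
    ultimately obtain x where x: "x \<in> P" "H x = 0"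
      using connected_space_zero[OF assms(2)] abcd unfolding P_def by metis
    obtain s where s: "volume_preserving_diffeo M \<mu> s"
      and refl: "\<And>y z. y \<in> P \<Longrightarrow> z \<in> P \<Longrightarrow> S x y z = - S x (s y) z"
      using symmetry[OF x(1)] by blast
    \<comment> \<open>Needed to apply the identities for \<open>S\<close> at the point
      \<open>s t\<close>.\<close>
    have sP: "s t \<in> P" if "t \<in> P" for t
      using s that unfolding volume_preserving_diffeo_def diffeomorphism_def P_def
      by (auto dest: bij_betwE)
    have "S a b t + S t c d = S a (s t) d + S (s t) b c" if t: "t \<in> P" for t
    proof -
      \<comment> \<open>The symmetry is given with \<open>x\<close> in the first slot, whereas the
        cocycle identity puts \<open>x\<close> last; cyclic shifts and antisymmetry translate
        between the two.\<close>
      have refl': "S (s t) z x = - S t z x" "S z (s t) x = - S z t x" if "z \<in> P" for z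
        using refl[OF t that] cyc[OF t that x(1)] cyc[OF sP[OF t] that x(1)]
          alt[OF t that x(1)] alt[OF sP[OF t] that x(1)] cyc[OF that t x(1)] cyc[OF that sP[OF t] x(1)]
          alt[OF that t x(1)] alt[OF that sP[OF t] x(1)] cyc[OF x(1) that t] cyc[OF x(1) that sP[OF t]]
        by linarith+
      have alt': "S z y x = - S y z x" if "y \<in> P" "z \<in> P" for y z
        using cyc[OF that x(1)] cyc[OF that(2,1) x(1)] alt[OF that(2,1) x(1)] alt[OF that x(1)]
          cyc[OF x(1) that] cyc[OF x(1) that(2,1)] by linarith
      show ?thesis
        \<comment> \<open>All four triangles are split at \<open>x\<close>. Each edge term at
          \<open>s t\<close> is minus the one at \<open>t\<close>, that is, the term of the reversed
          edge, so the terms in \<open>t\<close> cancel and the difference of the two sides is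
          \<open>H x\<close>.\<close>
        using cocycle[OF x(1) abcd(1,2) t] cocycle[OF x(1) t abcd(3,4)]
          cocycle[OF x(1) abcd(1) sP[OF t] abcd(4)] cocycle[OF x(1) sP[OF t] abcd(2,3)]
          refl'[OF abcd(1)] refl'[OF abcd(2)] refl'[OF abcd(3)] refl'[OF abcd(4)]
          alt'[OF t abcd(1)] alt'[OF t abcd(2)] alt'[OF t abcd(3)] alt'[OF t abcd(4)] x(2)
        unfolding H_def by linarith
    qed
    then show ?thesis using s by blast
  qed
  then have "\<exists>\<phi>. volume_preserving_diffeo M \<mu> \<phi> \<and>
      (\<forall>t\<in>P. exp (\<i> * complex_of_real (S a b t)) * exp (\<i> * complex_of_real (S t c d)) =
        exp (\<i> * complex_of_real (S a (\<phi> t) d)) * exp (\<i> * complex_of_real (S (\<phi> t) b c)))"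
    if "a \<in> P" "b \<in> P" "c \<in> P" "d \<in> P" for a b c d
    \<comment> \<open>The phases agree exactly as real numbers, so \<open>exp\<close> turns the
      identity of sums into one of products.\<close>
    using that by (simp flip: exp_add distrib_left of_real_add) metis
  then show ?thesis
    unfolding geometrically_associative_def Let_def P_def
    using smooth_kernel_exp_i[OF atl smooth] by blast
qed

end
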